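(* Let $X$ be an indeterminate. For all integers $n,r,s\geq 1$ one has $$\sum_{|\mu|=n} (-1)^{r-l(\mu)}\,\frac{\left\langle {\mu \atop r}\right\rangle}{z_\mu}\,X^{l(\mu)-1}\left(\sum_{i=1}^{l(\mu)} (\mu_i)_s\right) = (s-1)!\,\binom{n+s-1}{n-r}\left[\binom{X}{r}-\binom{X-s}{r}\right],$$ where the sum is over all partitions $\mu$ of weight $n$. Equivalently (changing $X$ into $-X$), $$\sum_{|\mu|=n} \frac{\left\langle {\mu \atop r}\right\rangle}{z_\mu}\,X^{l(\mu)-1}\left(\sum_{i=1}^{l(\mu)} (\mu_i)_s\right) = (s-1)!\,\binom{n+s-1}{n-r}\left[\binom{X+r+s-1}{r}-\binom{X+r-1}{r}\right].$$
   Context: A partition $\mu=(\mu_1,\ldots,\mu_l)$ is a finite weakly decreasing sequence of positive integers; $l(\mu)=l$ is its length, $|\mu|=\sum_i\mu_i$ its weight, and $m_i(\mu)=\#\{j:\mu_j=i\}$ the multiplicity of $i\ge1$ in $\mu$. Put $z_\mu=\prod_{i\ge1} i^{m_i(\mu)}\,m_i(\mu)!$. The (Ferrers) diagram of $\mu$ is $\{(i,j):1\le i\le l(\mu),\ 1\le j\le\mu_i\}$. For an integer $r\ge1$, $\left\langle {\mu \atop r}\right\rangle$ denotes the number of ways to choose $r$ points in the diagram of $\mu$ (i.e. the number of $r$-element subsets) such that at least one point is chosen in each row of $\mu$; equivalently $\sum_{r\ge1}\left\langle {\mu \atop r}\right\rangle q^r=\prod_{i=1}^{l(\mu)}\big((1+q)^{\mu_i}-1\big)$.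 Rising factorial: $(a)_s=a(a+1)\cdots(a+s-1)$. For $k\ge0$, $\binom{Y}{k}=\frac{Y(Y-1)\cdots(Y-k+1)}{k!}$; binomial coefficients with negative lower index are $0$. The identities are in $\mathbb{Q}[X]$. *)

theory Defs
  imports Complex_Main "HOL-Computational_Algebra.Polynomial"
begin

definition is_partition :: "nat list \<Rightarrow> bool" where
  "is_partition \<mu> \<longleftrightarrow> sorted_wrt (\<ge>) \<mu> \<and> (\<forall>m\<in>set \<mu>. m \<ge> 1)"

definition partitions_of :: "nat \<Rightarrow> nat list set" where
  "partitions_of n = {\<mu>. is_partition \<mu> \<and> sum_list \<mu> = n}"

(* Needed for sums over partitions_of n to be meaningful. *)
lemma finite_partitions_of: "finite (partitions_of n)"
proof -
  have len: "length \<mu> \<le> sum_list \<mu>" if "\<forall>m\<in>set \<mu>. m \<ge> 1" for \<mu> :: "nat list"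
    using that by (induction \<mu>) auto
  have "partitions_of n \<subseteq> {\<mu>. set \<mu> \<subseteq> {..n} \<and> length \<mu> \<le> n}"
    using len by (auto simp: partitions_of_def is_partition_def member_le_sum_list)
  then show ?thesis
    by (rule finite_subset) (simp add: finite_lists_length_le)
qed

(* The factor at i is 1 whenever i is not a part of \<mu>, so the product over all
   i \<ge> 1 is the product over the parts occurring in \<mu>; count_list \<mu> i is the
   multiplicity m_i(\<mu>). *)
definition zee :: "nat list \<Rightarrow> nat" where
  "zee \<mu> = (\<Prod>i\<in>set \<mu>. i ^ count_list \<mu> i * fact (count_list \<mu> i))"

(* Points are 1-based, list indices 0-based. *)
definition diagram :: "nat list \<Rightarrow> (nat \<times> nat) set" where
  "diagram \<mu> = {(i, j). 1 \<le> i \<and> i \<le> length \<mu> \<and> 1 \<le> j \<and> j \<le> \<mu> ! (i - 1)}"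

definition row_choices :: "nat list \<Rightarrow> nat \<Rightarrow> nat" where
  "row_choices \<mu> r =
     card {S. S \<subseteq> diagram \<mu> \<and> card S = r \<and> (\<forall>i\<in>{1..length \<mu>}. \<exists>j. (i, j) \<in> S)}"

lemma finite_diagram: "finite (diagram \<mu>)"
proof -
  have "diagram \<mu> \<subseteq> (SIGMA i:{1..length \<mu>}. {1..\<mu> ! (i - 1)})"
    by (auto simp: diagram_def)
  then show ?thesis
    by (rule finite_subset) auto
qed

(* Binomial coefficients vanish for negative lower index. *)
definition binom :: "nat \<Rightarrow> int \<Rightarrow> nat" where
  "binom m k = (if k < 0 then 0 else m choose nat k)"

abbreviation indet :: "rat poly" where
  "indet \<equiv> [:0, 1:]"

(* gchoose requires field_char_0, so it cannot be used on rat poly. *)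
definition poly_binom :: "rat poly \<Rightarrow> nat \<Rightarrow> rat poly" (infix \<open>pchoose\<close> 64) where
  "Y pchoose k = smult (1 / fact k) (\<Prod>i<k. Y - of_nat i)"

lemma poly_pchoose: "poly (Y pchoose k) x = poly Y x gchoose k"
  by (simp add: poly_binom_def poly_prod gbinomial_prod_rev atLeast0LessThan)

end

theory Submission
  imports Defs "HOL-Library.Multiset" "HOL-Library.FuncSet"
    "HOL-Computational_Algebra.Formal_Power_Series"
begin

text \<open>
  The identity is the comparison of the coefficients of \<open>t ^ n * q ^ r\<close> in a generating
  function that has a closed form. Let \<open>f k = x * ((1 + q) ^ k - 1)\<close>. The product of \<open>f\<close>
  over the parts of a partition is \<open>x ^ l\<close> times the generating function in \<open>q\<close> of the
  choices of points that meet every row (\<open>row_choices_gf\<close>). Summing these products with the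
  weights \<open>1 / z\<close> and the variable \<open>t\<close> for the size of the partition gives
  \<open>exp (\<Sum>k\<ge>1. f k * t ^ k / k) = ((1 - t) / (1 - (1 + q) * t)) ^ x\<close>
  (\<open>weighted_partition_sum_gf\<close>).

  A further factor \<open>\<Sum>i. g (\<mu> ! i)\<close> marks one part of the partition and only multiplies
  this generating function by \<open>\<Sum>k\<ge>1. g k * f k * t ^ k / k\<close> (\<open>partition_sum_marked\<close>). The
  choice \<open>g k = k\<close> yields the differential equation that determines the exponential above. For
  the rising factorial \<open>g k = pochhammer k s\<close> the factor is
  \<open>x * (s - 1)! * ((1 - (1 + q) * t) ^ (- s) - (1 - t) ^ (- s))\<close> (\<open>pochhammer_gf\<close>). With
  \<open>u = t / (1 - t)\<close>, so that \<open>1 - (1 + q) * t = (1 - t) * (1 - q * u)\<close>, the product is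
  \<open>x * (s - 1)! * (1 - t) ^ (- s) * ((1 - q * u) ^ (- x - s) - (1 - q * u) ^ (- x))\<close>,
  and the binomial series, first in \<open>q * u\<close> and then in \<open>t\<close>, gives the right-hand side
  of the second identity (\<open>quotient_power_coeff\<close>, \<open>marked_partition_sum_eval\<close>).

  The computation is made with power series in \<open>t\<close> alone, \<open>q\<close> being a number and \<open>x\<close> a
  positive integer: this keeps every power an ordinary one. Since both sides are polynomials in
  \<open>q\<close> and in \<open>x\<close>, these values determine them. The first identity is the second one
  at \<open>- X\<close>, multiplied by \<open>(-1) ^ (r - 1)\<close>.
\<close>

section \<open>Weighted sums over partitions\<close>

text \<open>
  The proof removes a part from a partition and puts one back. As multisets, partitions
  do not have to be re-sorted for that.
\<close>

definition mset_partitions :: "nat \<Rightarrow> nat multiset set" where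
  "mset_partitions n = {M. 0 \<notin># M \<and> \<Sum>\<^sub># M = n}"

definition zee_mset :: "nat multiset \<Rightarrow> nat" where
  "zee_mset M = (\<Prod>i\<in>set_mset M. i ^ count M i * fact (count M i))"

lemma zee_conv_mset: "zee \<mu> = zee_mset (mset \<mu>)"
  by (simp add: zee_def zee_mset_def count_mset)

lemma bij_betw_mset_partitions: "bij_betw mset (partitions_of n) (mset_partitions n)"
proof (rule bij_betw_byWitness[where f' = "\<lambda>M. rev (sorted_list_of_multiset M)"])
  have "rev (sort \<mu>) = \<mu>" if "sorted_wrt (\<ge>) \<mu>" for \<mu> :: "nat list"
  proof -
    have "sorted (rev \<mu>)"
      using that by (simp add: sorted_wrt_rev)
    then have "sort \<mu> = rev \<mu>"
      by (intro properties_for_sort) auto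
    then show ?thesis by simp
  qed
  then show "\<forall>\<mu>\<in>partitions_of n. rev (sorted_list_of_multiset (mset \<mu>)) = \<mu>"
    by (auto simp: partitions_of_def is_partition_def)
  show "\<forall>M\<in>mset_partitions n. mset (rev (sorted_list_of_multiset M)) = M"
    by simp
  show "mset ` partitions_of n \<subseteq> mset_partitions n"
    by (fastforce simp: partitions_of_def is_partition_def mset_partitions_def sum_mset_sum_list)
  show "(\<lambda>M. rev (sorted_list_of_multiset M)) ` mset_partitions n \<subseteq> partitions_of n"
  proof clarify
    fix M assume M: "M \<in> mset_partitions n"
    have "sum_list (rev (sorted_list_of_multiset M)) = \<Sum>\<^sub># (mset (rev (sorted_list_of_multiset M)))"
      by (rule sum_mset_sum_list[symmetric])
    then have "sum_list (rev (sorted_list_of_multiset M)) = n"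
      using M by (simp add: mset_partitions_def)
    moreover have "m \<ge> 1" if "m \<in># M" for m
      using M that by (cases m) (auto simp: mset_partitions_def)
    ultimately show "rev (sorted_list_of_multiset M) \<in> partitions_of n"
      by (simp add: partitions_of_def is_partition_def sorted_wrt_rev)
  qed
qed

lemma finite_mset_partitions: "finite (mset_partitions n)"
  using bij_betw_finite[OF bij_betw_mset_partitions] finite_partitions_of by blast

lemma sum_partitions_conv_mset:
  "(\<Sum>\<mu>\<in>partitions_of n. h (mset \<mu>)) = (\<Sum>M\<in>mset_partitions n. h M)"
  by (rule sum.reindex_bij_betw[OF bij_betw_mset_partitions])

text \<open>
  This recursion is the reason why \<open>1 / z\<close> is the right weight: a marked copy of the part
  \<open>k\<close> can be picked in \<open>count M k + 1\<close> ways after \<open>k\<close> has been added, and that number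
  cancels, leaving just \<open>1 / k\<close>.
\<close>

lemma zee_mset_add_mset: "zee_mset (add_mset k M) = k * Suc (count M k) * zee_mset M"
proof -
  let ?h = "\<lambda>M i. i ^ count M i * (fact (count M i) :: nat)"
  have ext: "zee_mset N = ?h N k * (\<Prod>i\<in>set_mset M - {k}. ?h N i)"
    if "set_mset N = set_mset M \<or> set_mset N = insert k (set_mset M)" for N
  proof (cases "k \<in># N")
    case True
    then have "set_mset N - {k} = set_mset M - {k}" using that by auto
    then show ?thesis
      unfolding zee_mset_def using True by (subst prod.remove[of _ k]) auto
  next
    case False
    then have "set_mset N = set_mset M - {k}" "count N k = 0"
      using that False by (auto simp: count_eq_zero_iff)
    then show ?thesis unfolding zee_mset_def by simp
  qed
  have "(\<Prod>i\<in>set_mset M - {k}. ?h (add_mset k M) i) = (\<Prod>i\<in>set_mset M - {k}. ?h M i)"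
    by (intro prod.cong) auto
  then show ?thesis
    by (subst (1 2) ext) (simp_all add: algebra_simps)
qed

lemma zee_mset_pos: "0 \<notin># M \<Longrightarrow> zee_mset M > 0"
  unfolding zee_mset_def by (intro prod_pos) (auto intro: gr0I)

text \<open>
  The coefficient of \<open>t ^ n\<close> in \<open>exp (\<Sum>k\<ge>1. f k * t ^ k / k)\<close>; in the language of
  symmetric functions, the complete symmetric function \<open>h\<^sub>n\<close> when the \<open>f k\<close> are the power sums.
\<close>

definition weighted_partition_sum :: "(nat \<Rightarrow> 'a::field_char_0) \<Rightarrow> nat \<Rightarrow> 'a" where
  "weighted_partition_sum f n =
     (\<Sum>M\<in>mset_partitions n. (\<Prod>k\<in>#M. f k) / of_nat (zee_mset M))"

lemma sum_mset_conv_count: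
  "(\<Sum>k\<in>#M. g k) = (\<Sum>k\<in>set_mset M. of_nat (count M k) * (g k :: 'a :: comm_semiring_1))"
proof -
  have "finite A \<Longrightarrow> set_mset M \<subseteq> A \<Longrightarrow>
     (\<Sum>k\<in>#M. g k) = (\<Sum>k\<in>A. of_nat (count M k) * g k)" for A
  proof (induction M)
    case (add x M)
    have "(\<Sum>k\<in>A. of_nat (count (add_mset x M) k) * g k)
        = (\<Sum>k\<in>A. of_nat (count M k) * g k + (if k = x then g k else 0))"
      by (intro sum.cong) (auto simp: algebra_simps)
    also have "\<dots> = (\<Sum>k\<in>A. of_nat (count M k) * g k) + g x"
      using add.prems by (simp add: sum.distrib sum.delta)
    finally show ?case using add by (simp add: add.commute)
  qed auto
  then show ?thesis by simp
qed

text \<open>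
  Expanding \<open>\<Sum>k\<in>#M. g k\<close> marks one part of every partition. Removing the marked part
  \<open>k\<close> leaves an arbitrary partition of \<open>n - k\<close>, and by \<open>zee_mset_add_mset\<close> each
  pair of a part and a smaller partition is counted with the factor \<open>1 / k\<close>. In terms of
  generating functions: deriving \<open>exp (\<Sum>k. f k * (1 + \<epsilon> * g k) * t ^ k / k)\<close> with
  respect to \<open>\<epsilon>\<close> at \<open>0\<close> brings down one factor \<open>\<Sum>k. g k * f k * t ^ k / k\<close>.
\<close>

lemma partition_sum_marked:
  fixes f g :: "nat \<Rightarrow> 'a::field_char_0"
  shows "(\<Sum>M\<in>mset_partitions n. (\<Prod>k\<in>#M. f k) / of_nat (zee_mset M) * (\<Sum>k\<in>#M. g k))
       = (\<Sum>k=1..n. g k * f k / of_nat k * weighted_partition_sum f (n - k))"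
proof -
  let ?w = "\<lambda>M. (\<Prod>k\<in>#M. f k) / of_nat (zee_mset M)"
  have "(\<Sum>M\<in>mset_partitions n. ?w M * (\<Sum>k\<in>#M. g k))
      = (\<Sum>M\<in>mset_partitions n. \<Sum>k\<in>set_mset M. ?w M * (of_nat (count M k) * g k))"
    by (simp only: sum_mset_conv_count sum_distrib_left)
  also have "\<dots> = (\<Sum>(M, k)\<in>Sigma (mset_partitions n) set_mset.
                     ?w M * (of_nat (count M k) * g k))"
    by (intro sum.Sigma finite_mset_partitions) auto
  also have "\<dots> = (\<Sum>(k, N)\<in>Sigma {1..n} (\<lambda>k. mset_partitions (n - k)).
                     g k * f k / of_nat k * ?w N)"
  \<comment> \<open>Remove the marked part, or put it back.\<close>
  proof (rule sum.reindex_bij_witness[where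
        i = "\<lambda>(k, N). (add_mset k N, k)" and j = "\<lambda>(M, k). (k, M - {#k#})"], goal_cases)
    case (2 a)
    then obtain M k where a: "a = (M, k)" and M: "M \<in> mset_partitions n" and k: "k \<in># M"
      by auto
    then obtain N where N: "M = add_mset k N" by (metis multi_member_split)
    have "k \<noteq> 0" using M k by (auto simp: mset_partitions_def intro: ccontr)
    then show ?case using M N a by (auto simp: mset_partitions_def)
  next
    case (5 a)
    then obtain M k where a: "a = (M, k)" and M: "M \<in> mset_partitions n" and k: "k \<in># M"
      by auto
    then obtain N where N: "M = add_mset k N" by (metis multi_member_split)
    have "k \<noteq> 0" using M k by (auto simp: mset_partitions_def intro: ccontr)
    moreover have "zee_mset N > 0"
      using M N by (intro zee_mset_pos) (auto simp: mset_partitions_def)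
    moreover have "(of_nat (Suc (count N k)) :: 'a) \<noteq> 0"
      by (rule of_nat_neq_0)
    ultimately show ?case 
      using a N by (simp add: zee_mset_add_mset field_simps del: of_nat_Suc mult_Suc_right)
  qed (auto simp: mset_partitions_def)
  also have "\<dots> = (\<Sum>k=1..n. g k * f k / of_nat k * weighted_partition_sum f (n - k))"
    unfolding weighted_partition_sum_def sum_distrib_left
    by (intro sum.Sigma[symmetric]) (auto simp: finite_mset_partitions)
  finally show ?thesis .
qed

text \<open>
  Newton's identity. With \<open>g k = k\<close> the marked sum is \<open>n\<close> times the unmarked one.
\<close>

lemma weighted_partition_sum_rec:
  "of_nat n * weighted_partition_sum f n = (\<Sum>k=1..n. f k * weighted_partition_sum f (n - k))"
proof -
  have "(\<Sum>k\<in>#M. of_nat k :: 'a) = of_nat n" if "M \<in> mset_partitions n" for M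
    using that by (auto simp: mset_partitions_def of_nat_sum_mset)
  then have "of_nat n * weighted_partition_sum f n = 
    (\<Sum>M\<in>mset_partitions n. (\<Prod>k\<in>#M. f k) / of_nat (zee_mset M) * (\<Sum>k\<in>#M. of_nat k))"
    by (simp add: weighted_partition_sum_def sum_distrib_left mult.commute)
  also have "\<dots> = (\<Sum>k=1..n. f k * weighted_partition_sum f (n - k))"
    unfolding partition_sum_marked by (intro sum.cong) auto
  finally show ?thesis .
qed

lemma weighted_partition_sum_0 [simp]: "weighted_partition_sum f 0 = 1"
proof -
  have "mset_partitions 0 = {{#}}"
    by (auto simp: mset_partitions_def) (metis multiset_nonemptyE)
  then show ?thesis by (simp add: weighted_partition_sum_def zee_mset_def)
qed

section \<open>Choices of points meeting every row\<close>

lemma diagram_conv_Sigma: "diagram \<mu> = (SIGMA i:{1..length \<mu>}. {1..\<mu> ! (i - 1)})"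
  by (auto simp: diagram_def)

lemma card_diagram: "card (diagram \<mu>) = sum_list \<mu>"
proof -
  have "card (diagram \<mu>) = (\<Sum>i=1..length \<mu>. \<mu> ! (i - 1))"
    by (simp add: diagram_conv_Sigma card_SigmaI)
  also have "\<dots> = (\<Sum>i<length \<mu>. \<mu> ! i)"
    by (rule sum.reindex_bij_witness[of _ Suc "\<lambda>i. i - 1"]) auto
  finally show ?thesis
    by (simp add: sum_list_sum_nth atLeast0LessThan)
qed

lemma row_choices_eq_0: "sum_list \<mu> < r \<Longrightarrow> row_choices \<mu> r = 0"
proof -
  assume r: "sum_list \<mu> < r"
  have "card S \<noteq> r" if "S \<subseteq> diagram \<mu>" for S
    using card_mono[OF finite_diagram that] r by (simp add: card_diagram)
  then have "{S. S \<subseteq> diagram \<mu> \<and> card S = r \<and> (\<forall>i\<in>{1..length \<mu>}. \<exists>j. (i, j) \<in> S)} = {}"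
    by blast
  then show ?thesis by (simp only: row_choices_def card.empty)
qed

lemma sum_power_card_nonempty_subsets:
  fixes q :: "'a::comm_ring_1"
  assumes "finite A"
  shows "(\<Sum>T\<in>Pow A - {{}}. q ^ card T) = (1 + q) ^ card A - 1"
proof -
  have "(1 + q) ^ card A = (\<Sum>T\<in>Pow A. q ^ card T)"
    using prod_add[OF assms, of "\<lambda>_. q" "\<lambda>_. 1"] by (simp add: add.commute)
  moreover have "(\<Sum>T\<in>Pow A. q ^ card T) = 1 + (\<Sum>T\<in>Pow A - {{}}. q ^ card T)"
    using sum.remove[of "Pow A" "{}" "\<lambda>T. q ^ card T"] assms by simp
  ultimately show ?thesis by simp
qed

text \<open>
  A choice that meets every row is a family of nonempty subsets, one of each row, and the
  number of chosen points is additive over the rows; so the generating function is the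
  product of the ones for the single rows.
\<close>

lemma row_choices_gf:
  fixes q :: "'a::comm_ring_1"
  shows "(\<Sum>r\<le>sum_list \<mu>. of_nat (row_choices \<mu> r) * q ^ r) = (\<Prod>k\<leftarrow>\<mu>. (1 + q) ^ k - 1)"
proof -
  let ?I = "{1..length \<mu>}"
  let ?R = "\<lambda>i. {1..\<mu> ! (i - 1)}"
  define Ch where "Ch = {S. S \<subseteq> diagram \<mu> \<and> (\<forall>i\<in>?I. \<exists>j. (i, j) \<in> S)}"
  have fin: "finite Ch"
    by (rule finite_subset[of _ "Pow (diagram \<mu>)"]) (auto simp: Ch_def finite_diagram)
  have "(\<Prod>k\<leftarrow>\<mu>. (1 + q) ^ k - 1) = (\<Prod>i<length \<mu>. (1 + q) ^ (\<mu> ! i) - 1)"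
    by (simp add: prod.list_conv_set_nth atLeast0LessThan)
  also have "\<dots> = (\<Prod>i\<in>?I. (1 + q) ^ (\<mu> ! (i - 1)) - 1)"
    by (rule prod.reindex_bij_witness[of _ "\<lambda>i. i - 1" Suc]) auto
  also have "\<dots> = (\<Prod>i\<in>?I. \<Sum>T\<in>Pow (?R i) - {{}}. q ^ card T)"
    by (simp add: sum_power_card_nonempty_subsets)
  also have "\<dots> = (\<Sum>g\<in>PiE ?I (\<lambda>i. Pow (?R i) - {{}}). \<Prod>i\<in>?I. q ^ card (g i))"
    by (rule prod_sum_PiE) auto
  also have "\<dots> = (\<Sum>S\<in>Ch. q ^ card S)"
  \<comment> \<open>A choice of points is the disjoint union of its rows.\<close>
  proof (rule sum.reindex_bij_witness[where
        i = "\<lambda>S. \<lambda>i\<in>?I. {j. (i, j) \<in> S}" and j = "\<lambda>g. Sigma ?I g"], goal_cases)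
    case (1 g)
    show ?case
    proof
      fix i show "(\<lambda>i\<in>?I. {j. (i, j) \<in> Sigma ?I g}) i = g i"
        using 1 by (cases "i \<in> ?I") (auto simp: PiE_def extensional_def)
    qed
  next
    case (2 g)
    then show ?case
      unfolding Ch_def diagram_conv_Sigma by (fastforce simp: PiE_iff)
  next
    case (5 g)
    have "finite (g i)" if "i \<in> ?I" for i
      using PiE_mem[OF 5 that] by (auto intro: finite_subset)
    then show ?case by (simp add: card_SigmaI power_sum)
  qed (auto simp: Ch_def diagram_conv_Sigma PiE_iff)
  also have "\<dots> = (\<Sum>r\<le>sum_list \<mu>. \<Sum>S\<in>{S\<in>Ch. card S = r}. q ^ card S)"
    by (rule sum.group[symmetric])
       (auto simp: fin Ch_def card_diagram[symmetric] intro!: card_mono finite_diagram)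
  also have "\<dots> = (\<Sum>r\<le>sum_list \<mu>. of_nat (row_choices \<mu> r) * q ^ r)"
    by (intro sum.cong refl) (simp add: row_choices_def Ch_def conj_ac)
  finally show ?thesis ..
qed

section \<open>Evaluation of the generating functions\<close>

unbundle fps_syntax

lemma fps_linear_ode_unique:
  fixes F P Q :: "'a::field_char_0 fps"
  assumes "F $ 0 = 0" "P $ 0 = Q $ 0"
    and P: "fps_X * fps_deriv P = F * P" and Q: "fps_X * fps_deriv Q = F * Q"
  shows "P = Q"
proof (rule fps_ext)
  fix n show "P $ n = Q $ n"
  proof (induction n rule: less_induct)
    case (less n)
    show ?case
    proof (cases n)
      case 0
      then show ?thesis using assms by simp
    next
      case (Suc m)
      have *: "of_nat n * R $ n = (\<Sum>i\<in>{1..n}. F $ i * R $ (n - i))"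
        if "fps_X * fps_deriv R = F * R" for R
      proof -
        have "of_nat n * R $ n = (fps_X * fps_deriv R) $ n"
          by (simp add: Suc)
        also have "\<dots> = (\<Sum>i=0..n. F $ i * R $ (n - i))"
          by (simp only: that fps_mult_nth)
        also have "\<dots> = (\<Sum>i\<in>{1..n}. F $ i * R $ (n - i))"
          using \<open>F $ 0 = 0\<close> by (simp add: sum.atLeast_Suc_atMost)
        finally show ?thesis .
      qed
      have "of_nat n * P $ n = of_nat n * Q $ n"
        unfolding *[OF P] *[OF Q] by (intro sum.cong) (auto simp: less)
      moreover have "of_nat n \<noteq> (0::'a)" using Suc by (simp del: of_nat_Suc)
      ultimately show ?thesis by simp
    qed
  qed
qed

lemma fps_geometric: "inverse (1 - fps_const c * fps_X) = Abs_fps (\<lambda>n. c ^ n :: 'a::field_char_0)"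
  using one_minus_const_fps_X_neg_power'[of 1 c] by (simp add: fps_eq_iff)

text \<open>
  Formally the left-hand side is \<open>exp (x * \<Sum>k\<ge>1. (c ^ k - 1) * t ^ k / k)\<close>, and the
  exponent is \<open>x * (ln (1 - t) - ln (1 - c * t))\<close>. Logarithms are avoided by taking \<open>x\<close> to be a
  natural number and by comparing logarithmic derivatives: Newton's identity says that the
  left-hand side satisfies \<open>t * P' = F * P\<close> with \<open>F = \<Sum>k. x * (c ^ k - 1) * t ^ k\<close>, and
  the geometric series show the same for the right-hand side.
\<close>

lemma weighted_partition_sum_gf:
  fixes c :: "'a::field_char_0"
  shows "Abs_fps (weighted_partition_sum (\<lambda>k. of_nat x * (c ^ k - 1)))
       = ((1 - fps_X) * inverse (1 - fps_const c * fps_X)) ^ x"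
    (is "?P = (?A * inverse ?B) ^ x")
proof (rule fps_linear_ode_unique)
  let ?f = "\<lambda>k. of_nat x * (c ^ k - 1)"
  show "Abs_fps ?f $ 0 = 0" by simp
  show "?P $ 0 = ((?A * inverse ?B) ^ x) $ 0" by (simp add: fps_power_zeroth)
  show "fps_X * fps_deriv ?P = Abs_fps ?f * ?P"
  proof (rule fps_ext)
    fix n show "(fps_X * fps_deriv ?P) $ n = (Abs_fps ?f * ?P) $ n"
    proof -
      have "(fps_X * fps_deriv ?P) $ n = of_nat n * weighted_partition_sum ?f n"
        by (cases n) simp_all
      also have "\<dots> = (\<Sum>k=1..n. ?f k * weighted_partition_sum ?f (n - k))"
        by (rule weighted_partition_sum_rec)
      also have "\<dots> = (Abs_fps ?f * ?P) $ n"
        by (simp add: fps_mult_nth sum.atLeast_Suc_atMost[of 0])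
      finally show ?thesis .
    qed
  qed
  have A: "inverse ?A = Abs_fps (\<lambda>n. 1)"
    using fps_geometric[of "1::'a"] by simp
  have F: "Abs_fps ?f = of_nat x * (inverse ?B - inverse ?A)"
    unfolding A fps_geometric by (simp add: fps_eq_iff fps_of_nat[symmetric])
  have AA: "?A * inverse ?A = 1" and BB: "?B * inverse ?B = 1"
    by (auto intro!: inverse_mult_eq_1')
  have dA: "fps_deriv ?A = -1" by simp
  have dB: "fps_deriv (inverse ?B) = fps_const c * inverse ?B ^ 2"
    by (subst fps_inverse_deriv) simp_all
  have D: "fps_X * fps_deriv (?A * inverse ?B) = (inverse ?B - inverse ?A) * (?A * inverse ?B)"
  proof -
    have "fps_X * fps_deriv (?A * inverse ?B)
        = ?A * (fps_const c * fps_X) * inverse ?B ^ 2 - fps_X * inverse ?B"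
      by (simp only: fps_deriv_mult dA dB) (simp add: algebra_simps)
    also have "\<dots> = ?A * (1 - ?B) * inverse ?B ^ 2 - (1 - ?A) * inverse ?B"
      by (simp add: algebra_simps)
    also have "\<dots> = (?A * inverse ?B) * inverse ?B
                - (?A * inverse ?B) * (?B * inverse ?B) - (1 - ?A) * inverse ?B"
      by (simp add: algebra_simps power2_eq_square)
    also have "\<dots> = (inverse ?B) * (?A * inverse ?B) - inverse ?B"
      unfolding BB by (simp add: algebra_simps)
    also have "\<dots> = (inverse ?B) * (?A * inverse ?B) - (?A * inverse ?A) * inverse ?B"
      unfolding AA by simp
    finally show ?thesis by (simp add: algebra_simps)
  qed
  show "fps_X * fps_deriv ((?A * inverse ?B) ^ x) = Abs_fps ?f * (?A * inverse ?B) ^ x"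
  proof (cases x)
    case (Suc y)
    have "fps_X * fps_deriv ((?A * inverse ?B) ^ x)
        = of_nat x * (fps_X * fps_deriv (?A * inverse ?B)) * (?A * inverse ?B) ^ y"
      by (simp only: fps_deriv_power Suc diff_Suc_1 fps_of_nat mult_ac)
    then show ?thesis
      unfolding D F by (simp add: Suc mult_ac)
  qed (simp add: fps_eq_iff fps_mult_nth)
qed

lemma pochhammer_over_nat:
  assumes "s > 0" "k > 0"
  shows "of_nat (pochhammer k s) / of_nat k
       = (fact (s - 1) * of_nat ((s + k - 1) choose k) :: 'a::field_char_0)"
proof -
  obtain s' k' where sk: "s = Suc s'" "k = Suc k'"
    using assms by (metis gr0_conv_Suc)
  have "pochhammer k s * fact (k - 1) = (fact (s + k - 1) :: nat)"
    using pochhammer_product'[of "1::nat" "k - 1" s] by (simp add: sk pochhammer_fact add_ac)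
  moreover have "fact (s + k - 1) = fact (s - 1) * fact k * ((s + k - 1) choose k)"
    using binomial_fact_lemma[of k "s + k - 1"] by (simp add: sk mult_ac)
  ultimately have "pochhammer k s * fact (k - 1) = (fact (s - 1) * ((s + k - 1) choose k) * k) * fact (k - 1)"
    using fact_reduce[of k, where 'a = nat] assms by (simp only: mult_ac of_nat_id)
  then have "pochhammer k s = fact (s - 1) * ((s + k - 1) choose k) * k"
    by simp
  then show ?thesis using assms by simp
qed

text \<open>
  By \<open>pochhammer_over_nat\<close> both sides are differences of binomial series. The term at
  \<open>k = 0\<close> is the one where that lemma does not apply, and there both sides vanish.
\<close>

lemma pochhammer_gf:
  fixes c :: "'a::field_char_0"
  assumes "s > 0"
  shows "Abs_fps (\<lambda>k. of_nat (pochhammer k s) * (c ^ k - 1) / of_nat k)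
       = fact (s - 1) * (inverse (1 - fps_const c * fps_X) ^ s - inverse (1 - fps_X) ^ s)"
proof -
  have "inverse (1 - fps_const c * fps_X) ^ s = Abs_fps (\<lambda>k. of_nat ((s + k - 1) choose k) * c ^ k)" for c :: 'a
    using one_minus_const_fps_X_neg_power'[OF assms, of c] by (simp add: fps_inverse_power)
  from this[of c] this[of 1] 
  have *: "inverse (1 - fps_const c * fps_X) ^ s = Abs_fps (\<lambda>k. of_nat ((s + k - 1) choose k) * c ^ k)"
    "inverse (1 - fps_X :: 'a fps) ^ s = Abs_fps (\<lambda>k. of_nat ((s + k - 1) choose k))"
    by simp_all
  have fc: "(fact (s - 1) :: 'a fps) = fps_const (fact (s - 1))"
    by (metis fps_of_nat of_nat_fact)
  show ?thesis
  proof (rule fps_ext)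
    fix k show "Abs_fps (\<lambda>k. of_nat (pochhammer k s) * (c ^ k - 1) / of_nat k) $ k
        = (fact (s - 1) * (inverse (1 - fps_const c * fps_X) ^ s - inverse (1 - fps_X) ^ s)) $ k"
      using pochhammer_over_nat[OF assms, of k, where 'a = 'a] unfolding * fc
      by (cases "k = 0") (simp_all add: field_simps)
  qed
qed

text \<open>
  The outer sum stops at \<open>n\<close>, whatever \<open>d\<close> is, because \<open>b ^ i\<close> starts at degree \<open>i\<close>.
\<close>

lemma fps_compose_mult_nth:
  fixes a b d :: "'a::comm_ring_1 fps"
  assumes "b $ 0 = 0"
  shows "((a oo b) * d) $ n = (\<Sum>i\<le>n. a $ i * (b ^ i * d) $ n)"
proof -
  have "(a oo b) $ j = (\<Sum>i\<le>n. a $ i * (b ^ i) $ j)" if "j \<le> n" for j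
  proof -
    have "(b ^ i) $ j = 0" if "i > j" for i
      using assms startsby_zero_power_prefix[of b i] that by auto
    then show ?thesis
      unfolding fps_compose_nth using that by (intro sum.mono_neutral_left) auto
  qed
  then have "((a oo b) * d) $ n = (\<Sum>j=0..n. \<Sum>i\<le>n. a $ i * (b ^ i) $ j * d $ (n - j))"
    by (simp add: fps_mult_nth sum_distrib_right)
  also have "\<dots> = (\<Sum>i\<le>n. a $ i * (b ^ i * d) $ n)"
    by (subst sum.swap) (simp add: fps_mult_nth sum_distrib_left mult.assoc)
  finally show ?thesis .
qed

text \<open>
  With \<open>u = t / (1 - t)\<close> the quotient \<open>(1 - (1 + q) * t) / (1 - t)\<close> is \<open>1 - q * u\<close>.
  So \<open>q\<close> enters only through the binomial series of \<open>(1 - q * u) ^ (- m)\<close>, and its \<open>r\<close>-th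
  term contributes \<open>t ^ r * (1 - t) ^ (- (r + s))\<close>, which is again a binomial series. This is
  where the two binomial factors of the theorem separate.
\<close>

lemma quotient_power_coeff:
  fixes q :: "'a::field_char_0"
  assumes "m > 0" "s > 0"
  shows "(((1 - fps_X) * inverse (1 - fps_const (1 + q) * fps_X)) ^ m * inverse (1 - fps_X) ^ s) $ n
       = (\<Sum>r\<le>n. of_nat ((m + r - 1) choose r) * of_nat ((n + s - 1) choose (n - r)) * q ^ r)"
proof -
  let ?A = "1 - fps_X :: 'a fps" and ?B = "1 - fps_const (1 + q) * fps_X"
  let ?u = "fps_X * inverse ?A" and ?C = "1 - fps_const q * fps_X"
  have u0: "?u $ 0 = 0" by simp
  have AA: "?A * inverse ?A = 1" by (auto intro!: inverse_mult_eq_1')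
  have "?C oo ?u = 1 - fps_const q * ?u"
    by (simp add: fps_compose_sub_distrib fps_compose_mult_distrib fps_X_fps_compose_startby0)
  also have "\<dots> = ?A * inverse ?A - fps_const q * ?u" unfolding AA ..
  also have "\<dots> = ?B * inverse ?A"
    by (simp add: algebra_simps fps_const_add[symmetric] del: fps_const_add)
  finally have "inverse ?C oo ?u = inverse (?B * inverse ?A)"
    by (simp add: fps_inverse_compose)
  also have "\<dots> = ?A * inverse ?B"
    by (simp add: fps_inverse_mult mult.commute)
  finally have "(?A * inverse ?B) ^ m = (inverse ?C oo ?u) ^ m" by simp
  also have "\<dots> = inverse (?C ^ m) oo ?u"
    by (simp add: fps_compose_power fps_inverse_power)
  also have "\<dots> = Abs_fps (\<lambda>r. of_nat ((m + r - 1) choose r) * q ^ r) oo ?u"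
    by (simp only: one_minus_const_fps_X_neg_power'[OF assms(1)])
  finally have "((?A * inverse ?B) ^ m * inverse ?A ^ s) $ n
      = (\<Sum>r\<le>n. of_nat ((m + r - 1) choose r) * q ^ r * (?u ^ r * inverse ?A ^ s) $ n)"
    by (simp only: fps_compose_mult_nth[OF u0] fps_nth_Abs_fps)
  also have "\<dots> = (\<Sum>r\<le>n. of_nat ((m + r - 1) choose r) * of_nat ((n + s - 1) choose (n - r)) * q ^ r)"
  proof (intro sum.cong refl)
    fix r assume "r \<in> {..n}"
    then have r: "r \<le> n" by simp
    have "?u ^ r * inverse ?A ^ s = fps_X ^ r * inverse ?A ^ (r + s)"
      by (simp add: power_mult_distrib power_add mult.assoc)
    also have "inverse ?A ^ (r + s) = Abs_fps (\<lambda>k. of_nat ((r + s + k - 1) choose k))"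
      using one_minus_const_fps_X_neg_power'[of "r + s" "1::'a"] assms
      by (simp add: fps_inverse_power)
    finally have "(?u ^ r * inverse ?A ^ s) $ n = of_nat ((n + s - 1) choose (n - r))"
      using r by (simp add: fps_X_power_mult_nth add_ac)
    then show "of_nat ((m + r - 1) choose r) * q ^ r * (?u ^ r * inverse ?A ^ s) $ n
      = of_nat ((m + r - 1) choose r) * of_nat ((n + s - 1) choose (n - r)) * q ^ r"
      by (simp only: mult_ac)
  qed
  finally show ?thesis .
qed

text \<open>
  The part weights are \<open>f k = x * ((1 + q) ^ k - 1)\<close>: the factor \<open>x\<close> records the length, and
  the power of \<open>q\<close> the number of chosen points. The marked part contributes
  \<open>(s - 1)! * ((1 - (1 + q) * t) ^ (- s) - (1 - t) ^ (- s))\<close>. Multiplied by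
  \<open>((1 - t) / (1 - (1 + q) * t)) ^ x\<close> this becomes \<open>(1 - t) ^ (- s)\<close> times the difference of
  the \<open>(x + s)\<close>-th and the \<open>x\<close>-th power of the quotient, which explains the difference of
  two binomial coefficients in the result.
\<close>

lemma marked_partition_sum_eval:
  fixes q :: "'a::field_char_0"
  assumes "x > 0" "s > 0"
  defines "f \<equiv> (\<lambda>k. of_nat x * ((1 + q) ^ k - 1))"
  shows "(\<Sum>M\<in>mset_partitions n. (\<Prod>k\<in>#M. f k) / of_nat (zee_mset M)
              * (\<Sum>k\<in>#M. of_nat (pochhammer k s)))
       = of_nat x * fact (s - 1) * (\<Sum>r\<le>n. of_nat ((n + s - 1) choose (n - r)) *
            (of_nat ((x + s + r - 1) choose r) - of_nat ((x + r - 1) choose r)) * q ^ r)"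
proof -
  let ?A = "1 - fps_X :: 'a fps" and ?B = "1 - fps_const (1 + q) * fps_X"
  let ?G = "Abs_fps (\<lambda>k. of_nat (pochhammer k s) * ((1 + q) ^ k - 1) / of_nat k)"
  have AA: "?A * inverse ?A = 1" by (auto intro!: inverse_mult_eq_1')
  have "(?A * inverse ?B) ^ s * inverse ?A ^ s = (inverse ?B * (?A * inverse ?A)) ^ s"
    by (simp only: power_mult_distrib mult_ac)
  then have Bs: "inverse ?B ^ s = (?A * inverse ?B) ^ s * inverse ?A ^ s"
    unfolding AA by simp
  have fc: "(fact (s - 1) :: 'a fps) = fps_const (fact (s - 1))"
    by (metis fps_of_nat of_nat_fact)
  have "(\<Sum>M\<in>mset_partitions n. (\<Prod>k\<in>#M. f k) / of_nat (zee_mset M)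
              * (\<Sum>k\<in>#M. of_nat (pochhammer k s)))
      = (\<Sum>k=1..n. of_nat (pochhammer k s) * f k / of_nat k * weighted_partition_sum f (n - k))"
    by (rule partition_sum_marked)
  also have "\<dots> = of_nat x * (\<Sum>k=1..n. ?G $ k * Abs_fps (weighted_partition_sum f) $ (n - k))"
    by (simp add: sum_distrib_left f_def mult_ac)
  also have "(\<Sum>k=1..n. ?G $ k * Abs_fps (weighted_partition_sum f) $ (n - k))
      = (?G * Abs_fps (weighted_partition_sum f)) $ n"
    by (simp add: fps_mult_nth sum.atLeast_Suc_atMost[of 0])
  also have "?G * Abs_fps (weighted_partition_sum f)
      = fact (s - 1) * ((?A * inverse ?B) ^ (x + s) * inverse ?A ^ s
                        - (?A * inverse ?B) ^ x * inverse ?A ^ s)"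
    unfolding pochhammer_gf[OF assms(2)] f_def weighted_partition_sum_gf Bs
    by (simp add: algebra_simps power_add)
  also have "\<dots> $ n = fact (s - 1) * (\<Sum>r\<le>n. of_nat ((n + s - 1) choose (n - r)) *
            (of_nat ((x + s + r - 1) choose r) - of_nat ((x + r - 1) choose r)) * q ^ r)"
    unfolding fc fps_mult_left_const_nth fps_sub_nth
    using assms by (subst (1 2) quotient_power_coeff) (simp_all add: algebra_simps sum_subtractf)
  finally show ?thesis by (simp add: mult.assoc)
qed

section \<open>From evaluations to polynomial identities\<close>

lemma polyfun_coeff_cong:
  fixes a b :: "nat \<Rightarrow> 'a::field_char_0"
  assumes "\<And>q. (\<Sum>r\<le>n. a r * q ^ r) = (\<Sum>r\<le>n. b r * q ^ r)" "r \<le> n"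
  shows "a r = b r"
proof -
  have "(\<Sum>i\<le>n. monom (a i) i) = (\<Sum>i\<le>n. monom (b i) i)"
    using assms(1) by (simp add: poly_eq_poly_eq_iff[symmetric] fun_eq_iff poly_sum poly_monom)
  from arg_cong[OF this, of "\<lambda>p. coeff p r"] show ?thesis
    using assms(2) by (simp add: coeff_sum)
qed

text \<open>
  The coefficient of \<open>q ^ r\<close> in \<open>marked_partition_sum_eval\<close>. The factor \<open>x\<close> is cancelled
  because the weights produce \<open>x ^ l\<close>, where \<open>l\<close> is the length, while the summand has
  \<open>x ^ (l - 1)\<close>.
\<close>

lemma marked_sum_at_nat:
  fixes x n r s :: nat
  assumes "x > 0" "n > 0" "s > 0" "r \<le> n"
  shows "(\<Sum>\<mu>\<in>partitions_of n. of_nat (row_choices \<mu> r) / of_nat (zee \<mu>)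
             * of_nat x ^ (length \<mu> - 1) * of_nat (\<Sum>i<length \<mu>. pochhammer (\<mu> ! i) s))
       = (fact (s - 1) * of_nat ((n + s - 1) choose (n - r)) *
            (of_nat ((x + s + r - 1) choose r) - of_nat ((x + r - 1) choose r)) :: 'a::field_char_0)"
    (is "?L r = ?R r")
proof -
  let ?S = "\<lambda>\<mu>. \<Sum>i<length \<mu>. pochhammer (\<mu> ! i) s"
  have "(\<Sum>r\<le>n. (of_nat x * ?L r) * q ^ r) = (\<Sum>r\<le>n. (of_nat x * ?R r) * q ^ r)" for q :: 'a
  proof -
    let ?f = "\<lambda>k. of_nat x * ((1 + q) ^ k - 1)"
    let ?h = "\<lambda>M. (\<Prod>k\<in>#M. ?f k) / of_nat (zee_mset M) * (\<Sum>k\<in>#M. of_nat (pochhammer k s))"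
    have "(\<Sum>r\<le>n. (of_nat x * ?L r) * q ^ r)
        = (\<Sum>\<mu>\<in>partitions_of n. \<Sum>r\<le>n. of_nat x * (of_nat (row_choices \<mu> r) / of_nat (zee \<mu>)
             * of_nat x ^ (length \<mu> - 1) * of_nat (?S \<mu>)) * q ^ r)"
      by (simp only: sum_distrib_left sum_distrib_right) (rule sum.swap)
    also have "\<dots> = (\<Sum>\<mu>\<in>partitions_of n. ?h (mset \<mu>))"
    proof (intro sum.cong refl)
      fix \<mu> assume \<mu>: "\<mu> \<in> partitions_of n"
      then have n: "sum_list \<mu> = n" and "length \<mu> > 0"
        using assms(2) by (auto simp: partitions_of_def)
      have prod: "(\<Prod>k\<in>#mset \<mu>. ?f k) = of_nat x ^ length \<mu> * (\<Prod>k\<leftarrow>\<mu>. (1 + q) ^ k - 1)"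
        unfolding mset_map[symmetric] prod_mset_prod_list by (induction \<mu>) simp_all
      have sum: "(\<Sum>k\<in>#mset \<mu>. of_nat (pochhammer k s)) = (of_nat (?S \<mu>) :: 'a)"
        unfolding mset_map[symmetric] sum_mset_sum_list
        by (simp add: sum.list_conv_set_nth atLeast0LessThan)
      have "(\<Sum>r\<le>n. of_nat x * (of_nat (row_choices \<mu> r) / of_nat (zee \<mu>)
               * of_nat x ^ (length \<mu> - 1) * of_nat (?S \<mu>)) * q ^ r)
          = (of_nat x * of_nat x ^ (length \<mu> - 1)) / of_nat (zee \<mu>) * of_nat (?S \<mu>)
               * (\<Sum>r\<le>n. of_nat (row_choices \<mu> r) * q ^ r)"
        unfolding sum_distrib_left by (intro sum.cong refl) (simp only: times_divide_eq_left times_divide_eq_right mult_ac)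
      also have "of_nat x * of_nat x ^ (length \<mu> - 1) = (of_nat x ^ length \<mu> :: 'a)"
        using \<open>length \<mu> > 0\<close> by (metis Suc_pred' power_Suc)
      also have "(\<Sum>r\<le>n. of_nat (row_choices \<mu> r) * q ^ r) = (\<Prod>k\<leftarrow>\<mu>. (1 + q) ^ k - 1)"
        using row_choices_gf[of \<mu> q] n by simp
      finally show "(\<Sum>r\<le>n. of_nat x * (of_nat (row_choices \<mu> r) / of_nat (zee \<mu>)
               * of_nat x ^ (length \<mu> - 1) * of_nat (?S \<mu>)) * q ^ r) = ?h (mset \<mu>)"
        unfolding prod sum zee_conv_mset by (simp only: mult_ac times_divide_eq_left times_divide_eq_right)
    qed
    also have "\<dots> = (\<Sum>M\<in>mset_partitions n. ?h M)"
      by (rule sum_partitions_conv_mset)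
    also have "\<dots> = (\<Sum>r\<le>n. (of_nat x * ?R r) * q ^ r)"
      unfolding marked_partition_sum_eval[OF assms(1,3)]
      by (simp only: sum_distrib_left mult_ac)
    finally show ?thesis .
  qed
  then have "of_nat x * ?L r = of_nat x * ?R r"
    by (rule polyfun_coeff_cong) fact
  then show ?thesis using assms(1) by simp
qed

lemma poly_eqI_pos_nat:
  fixes p q :: "'a::field_char_0 poly"
  assumes "\<And>x::nat. x > 0 \<Longrightarrow> poly p (of_nat x) = poly q (of_nat x)"
  shows "p = q"
proof (rule ccontr)
  assume "p \<noteq> q"
  then have "finite {x. poly (p - q) x = 0}"
    by (intro poly_roots_finite) simp
  moreover have "of_nat ` {0<..} \<subseteq> {x. poly (p - q) x = 0}"
    using assms by auto
  ultimately have "finite ((of_nat :: nat \<Rightarrow> 'a) ` {0<..})"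
    by (rule rev_finite_subset)
  then have "finite {0::nat<..}"
    by (rule finite_imageD) (simp add: inj_on_def)
  then show False using infinite_Ioi by blast
qed

text \<open>
  Both sides are polynomials in the indeterminate, so it suffices to know them at all positive
  integers. For \<open>r > n\<close> both sides are zero: there are not enough points in the diagram, and
  the lower index of the binomial coefficient is negative.
\<close>

lemma marked_sum_poly:
  fixes n r s :: nat
  assumes "n \<ge> 1" and "s \<ge> 1"
  shows "(\<Sum>\<mu>\<in>partitions_of n.
        smult (of_nat (row_choices \<mu> r) / of_nat (zee \<mu>))
          (indet ^ (length \<mu> - 1)) * of_nat (\<Sum>i<length \<mu>. pochhammer (\<mu> ! i) s))
      = fact (s - 1) * of_nat (binom (n + s - 1) (int n - int r))
          * (((indet + of_nat r + of_nat s - 1) pchoose r)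
             - ((indet + of_nat r - 1) pchoose r))"
    (is "?L = ?R")
proof (cases "r \<le> n")
  case False
  then have "row_choices \<mu> r = 0" if "\<mu> \<in> partitions_of n" for \<mu>
    using that by (intro row_choices_eq_0) (simp add: partitions_of_def)
  then show ?thesis using False by (simp add: binom_def)
next
  case True
  have fact_poly: "poly (fact m :: rat poly) y = fact m" for m y
    by (metis of_nat_fact poly_of_nat)
  show ?thesis
  proof (rule poly_eqI_pos_nat)
    fix x :: nat assume x: "x > 0"
    have "poly ?L (of_nat x) =
      (\<Sum>\<mu>\<in>partitions_of n. of_nat (row_choices \<mu> r) / of_nat (zee \<mu>)
             * of_nat x ^ (length \<mu> - 1) * of_nat (\<Sum>i<length \<mu>. pochhammer (\<mu> ! i) s))"
      by (simp add: poly_sum poly_of_nat mult.assoc)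
    also have "\<dots> = fact (s - 1) * of_nat ((n + s - 1) choose (n - r)) *
            (of_nat ((x + s + r - 1) choose r) - of_nat ((x + r - 1) choose r))"
      using assms True x by (intro marked_sum_at_nat) auto
    also have "\<dots> = poly ?R (of_nat x)"
    proof -
      have "of_nat (x + s + r - 1) = (of_nat x + of_nat r + of_nat s - 1 :: rat)"
           "of_nat (x + r - 1) = (of_nat x + of_nat r - 1 :: rat)"
        using x by (simp_all add: of_nat_diff)
      then show ?thesis
        using True
        by (simp only: poly_mult poly_diff poly_add poly_pchoose fact_poly poly_of_nat poly_1
            binomial_gbinomial[of "x + s + r - 1" r] binomial_gbinomial[of "x + r - 1" r] binom_def poly_pCons poly_0 of_nat_0_le_iff nat_int)
           (simp add: nat_diff_distrib)
    qed
    finally show "poly ?L (of_nat x) = poly ?R (of_nat x)" .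
  qed
qed

theorem mainTheorem1:
  fixes n r s :: nat
  assumes "n \<ge> 1" and "r \<ge> 1" and "s \<ge> 1"
  shows
    "(\<Sum>\<mu>\<in>partitions_of n.
        smult ((-1) powi (int r - int (length \<mu>)) * of_nat (row_choices \<mu> r) / of_nat (zee \<mu>))
          (indet ^ (length \<mu> - 1)) * of_nat (\<Sum>i<length \<mu>. pochhammer (\<mu> ! i) s))
      = fact (s - 1) * of_nat (binom (n + s - 1) (int n - int r))
          * ((indet pchoose r) - ((indet - of_nat s) pchoose r))
   \<and> (\<Sum>\<mu>\<in>partitions_of n.
        smult (of_nat (row_choices \<mu> r) / of_nat (zee \<mu>))
          (indet ^ (length \<mu> - 1)) * of_nat (\<Sum>i<length \<mu>. pochhammer (\<mu> ! i) s))
      = fact (s - 1) * of_nat (binom (n + s - 1) (int n - int r))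
          * (((indet + of_nat r + of_nat s - 1) pchoose r)
             - ((indet + of_nat r - 1) pchoose r))"
    (is "?L1 = ?K * ?D1 \<and> ?L2 = ?K * ?D2")
proof
  show eq2: "?L2 = ?K * ?D2"
    by (rule marked_sum_poly) fact+
  \<comment> \<open>Substitute \<open>- X\<close> for \<open>X\<close> in the second identity, multiply by \<open>(-1) ^ (r - 1)\<close>, and
  apply the reflection formula for binomial coefficients.\<close>
  show "?L1 = ?K * ?D1"
  proof (rule poly_eqI_pos_nat)
    fix x' :: nat
    define x where "x = (of_nat x' :: rat)"
    have divide_sign: "a / (-1) ^ k = a * (-1) ^ k" for a :: rat and k
      by (cases "even k") simp_all
    have sign: "(-1) powi (int r - int l) * x ^ (l - 1) = (-1) ^ (r - 1) * (- x) ^ (l - 1)"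
      if "l > 0" for l
    proof -
      have "int r - int l = int (r - 1) - int (l - 1)"
        using assms that by simp
      then have "(-1::rat) powi (int r - int l) = (-1) powi (int (r - 1) - int (l - 1))"
        by (rule arg_cong)
      also have "\<dots> = (-1) powi int (r - 1) / (-1) powi int (l - 1)"
        by (rule power_int_diff) simp
      also have "\<dots> = (-1) ^ (r - 1) / (-1) ^ (l - 1)"
        by (simp only: power_int_of_nat)
      also have "\<dots> = (-1) ^ (r - 1) * (-1) ^ (l - 1)"
        by (rule divide_sign)
      finally show ?thesis
        by (simp only: power_minus[of x "l - 1"] mult.assoc)
    qed
    have "poly ?L1 x = (-1) ^ (r - 1) * poly ?L2 (- x)"
      unfolding poly_sum sum_distrib_left
    proof (intro sum.cong refl)
      fix \<mu> assume "\<mu> \<in> partitions_of n"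
      then have "length \<mu> > 0" using assms by (auto simp: partitions_of_def)
      note sign = sign[OF this]
      let ?c = "of_nat (row_choices \<mu> r) / of_nat (zee \<mu>) :: rat"
      let ?l = "length \<mu>"
      let ?S = "\<Sum>i<length \<mu>. pochhammer (\<mu> ! i) s"
      have eval: "poly (smult c (indet ^ k) * of_nat m) y = c * y ^ k * of_nat m" for c k m y
        by (simp add: poly_of_nat)
      have "poly (smult ((-1) powi (int r - int ?l) * of_nat (row_choices \<mu> r) / of_nat (zee \<mu>))
              (indet ^ (?l - 1)) * of_nat ?S) x
          = ((-1) powi (int r - int ?l) * x ^ (?l - 1)) * (?c * of_nat ?S)"
        unfolding eval by (simp only: times_divide_eq_left times_divide_eq_right mult_ac)
      also have "\<dots> = (-1) ^ (r - 1) * poly (smult ?c (indet ^ (?l - 1)) * of_nat ?S) (- x)"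
        unfolding sign eval by (simp only: mult_ac)
      finally show "poly (smult ((-1) powi (int r - int ?l) * of_nat (row_choices \<mu> r) / of_nat (zee \<mu>))
              (indet ^ (?l - 1)) * of_nat ?S) x
          = (-1) ^ (r - 1) * poly (smult ?c (indet ^ (?l - 1)) * of_nat ?S) (- x)" .
    qed
    also have "\<dots> = poly ?K (- x) * ((-1) ^ (r - 1) * poly ?D2 (- x))"
      unfolding eq2 by (simp only: poly_mult mult_ac)
    also have "poly ?K (- x) = poly ?K x"
    proof -
      have "?K = of_nat (fact (s - 1) * binom (n + s - 1) (int n - int r))"
        by (simp only: of_nat_mult of_nat_fact)
      then show ?thesis by (simp only: poly_of_nat)
    qed
    also have "(-1) ^ (r - 1) * poly ?D2 (- x) = poly ?D1 x"
    proof -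
      have "(-1) ^ (r - 1) * (-1) ^ r = (-1 :: rat)"
        using assms(2) by (cases r) simp_all
      moreover have "poly ((indet + of_nat r + of_nat s - 1) pchoose r) (- x) = (-1) ^ r * ((x - of_nat s) gchoose r)"
        using gbinomial_negated_upper[of "x - of_nat s" r]
        by (simp add: poly_pchoose poly_of_nat algebra_simps)
      moreover have "poly ((indet + of_nat r - 1) pchoose r) (- x) = (-1) ^ r * (x gchoose r)"
        using gbinomial_negated_upper[of x r]
        by (simp add: poly_pchoose poly_of_nat algebra_simps)
      ultimately have "(-1) ^ (r - 1) * poly ?D2 (- x) = (- 1) * ((x - of_nat s) gchoose r) - (-1) * (x gchoose r)"
        by (simp only: poly_diff right_diff_distrib mult.assoc[symmetric])
      then show ?thesis by (simp add: poly_pchoose poly_of_nat)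
    qed
    finally show "poly ?L1 (of_nat x') = poly (?K * ?D1) (of_nat x')"
      by (simp add: x_def)
  qed
qed

end
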